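(* Let $k\ge2$ be an integer, let $s_k$ be the largest even number less than $k$, and let $\widetilde t_k$ be the largest odd number not exceeding $k$. Let $$G_k^{(0)}(\tau):=\big(g_{0,k}(\tau),g_{2,k}(\tau),\dots,g_{s_k,k}(\tau)\big)^{\mathrm T}.$$ Then for all $\tau$ with $\mathrm{Im}\,\tau>0$, $$G_k^{(0)}(\tau+1)=\mathrm{diag}\big(1,e^{\frac{2}{k}\pi i},\dots,e^{\frac{s_k^2}{2k}\pi i}\big)\,G_k^{(0)}(\tau),$$ $$G_k^{(0)}\Big(\frac{\tau}{4\tau+1}\Big)=\frac{4\sqrt{4\tau+1}}{k}\,B_k\widetilde\Lambda_kC_k\,G_k^{(0)}(\tau),$$ where $\widetilde\Lambda_k:=\mathrm{diag}\big(e^{-\frac{1}{2k}\pi i},e^{-\frac{9}{2k}\pi i},\dots,e^{-\frac{\widetilde t_k^{\,2}}{2k}\pi i}\big)$, and $B_k=(b_{ij})$, $C_k=(c_{ij})$ are the $\lfloor (k+1)/2\rfloor\times\lfloor (k+1)/2\rfloor$ matrices with $$b_{ij}:=\begin{cases}\cos\frac{(i-1)(2j-1)\pi}{k}, & 1\le i,j\le\frac k2\text{ and }k\text{ even},\\ \cos\frac{(i-1)(2j-1)\pi}{k}, & 1\le j\le\frac{k-1}{2}\text{ and }k\text{ odd},\\ \frac12\cos (i-1)\pi, & j=\frac{k+1}{2}\text{ and }k\text{ odd},\end{cases}\qquad c_{ij}:=\begin{cases}\frac12, & j=1,\\ \cos\frac{(2i-1)(j-1)\pi}{k}, & 2\le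 j\le\lfloor\frac{k+1}{2}\rfloor.\end{cases}$$
   Context: For integers $m\ge1$ and $j$, and $\mathrm{Im}\,\tau>0$, $q=e^{2\pi i\tau}$ (with $q^r:=e^{2\pi i r\tau}$ for rational $r$), define the theta series $g_{j,m}(\tau):=\sum_{n\in\mathbb Z}(-1)^n q^{m(n+\frac{j}{2m})^2}$. The diagonal entries of the first matrix are $e^{\frac{j^2}{2k}\pi i}$ for $j=0,2,\dots,s_k$, and those of $\widetilde\Lambda_k$ are $e^{-\frac{j^2}{2k}\pi i}$ for $j=1,3,\dots,\widetilde t_k$. Square roots denote the principal branch. *)

theory Defs
  imports
    "HOL-Analysis.Infinite_Sum"
    "Jordan_Normal_Form.Matrix"
begin

definition q_power :: "complex \<Rightarrow> real \<Rightarrow> complex" where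
  "q_power \<tau> r = exp (2 * of_real pi * \<i> * of_real r * \<tau>)"

definition theta_g :: "int \<Rightarrow> nat \<Rightarrow> complex \<Rightarrow> complex" where
  "theta_g j m \<tau> =
     (\<Sum>\<^sub>\<infinity>n\<in>(UNIV :: int set).
        (-1) powi n * q_power \<tau> (real m * (of_int n + of_int j / (2 * real m))\<^sup>2))"

definition s_max :: "nat \<Rightarrow> nat" where
  "s_max k = Max {s. even s \<and> s < k}"

definition t_max :: "nat \<Rightarrow> nat" where
  "t_max k = Max {t. odd t \<and> t \<le> k}"

(* Vectors and matrices of Jordan_Normal_Form are indexed from 0: position i of the vector
   and of the first diagonal matrix belongs to the even number j = 2 i of {0, 2, ..., s_max k},
   position i of Lambda_mat to the odd number j = 2 i + 1 of {1, 3, ..., t_max k}. *)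

definition G_vec :: "nat \<Rightarrow> complex \<Rightarrow> complex vec" where
  "G_vec k \<tau> = vec (s_max k div 2 + 1) (\<lambda>i. theta_g (int (2 * i)) k \<tau>)"

definition T_mat :: "nat \<Rightarrow> complex mat" where
  "T_mat k = mat_diag (s_max k div 2 + 1)
     (\<lambda>i. exp (of_nat ((2 * i)\<^sup>2) / (2 * of_nat k) * of_real pi * \<i>))"

definition Lambda_mat :: "nat \<Rightarrow> complex mat" where
  "Lambda_mat k = mat_diag (t_max k div 2 + 1)
     (\<lambda>i. exp (- (of_nat ((2 * i + 1)\<^sup>2) / (2 * of_nat k) * of_real pi * \<i>)))"

(* The entries b_entry k i j and c_entry k i j use the usual indices i, j >= 1. *)

definition b_entry :: "nat \<Rightarrow> nat \<Rightarrow> nat \<Rightarrow> real" where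
  "b_entry k i j =
     (if odd k \<and> j = (k + 1) div 2 then 1 / 2 * cos ((real i - 1) * pi)
      else cos ((real i - 1) * (2 * real j - 1) * pi / real k))"

definition c_entry :: "nat \<Rightarrow> nat \<Rightarrow> nat \<Rightarrow> real" where
  "c_entry k i j =
     (if j = 1 then 1 / 2
      else cos ((2 * real i - 1) * (real j - 1) * pi / real k))"

definition B_mat :: "nat \<Rightarrow> complex mat" where
  "B_mat k = mat ((k + 1) div 2) ((k + 1) div 2)
     (\<lambda>(i, j). complex_of_real (b_entry k (i + 1) (j + 1)))"

definition C_mat :: "nat \<Rightarrow> complex mat" where
  "C_mat k = mat ((k + 1) div 2) ((k + 1) div 2)
     (\<lambda>(i, j). complex_of_real (c_entry k (i + 1) (j + 1)))"

end

theory Submission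
  imports
    "HOL-Complex_Analysis.Conformal_Mappings"
    "HOL-Probability.Characteristic_Functions"
    Defs
begin

text \<open>
  Writing \<open>\<sigma> = \<tau> / (4 \<tau> + 1)\<close>, we have \<open>-1/\<sigma> = -4 - 1/\<tau>\<close>. Poisson summation for a Gaussian expresses
  \<open>g\<^sub>2\<^sub>r(\<sigma>)\<close> through the exponentials of \<open>-m\<^sup>2/\<sigma>\<close> with \<open>m\<close> odd. The shift by \<open>-4\<close> contributes a factor
  that depends only on \<open>m\<close> modulo \<open>2 k\<close>, and a second Poisson summation over each residue class leads
  back to \<open>g\<^sub>2\<^sub>v(\<tau>)\<close>. The resulting double sum over residues modulo \<open>k\<close> folds under \<open>m \<rightarrow> -m\<close> and
  \<open>v \<rightarrow> -v\<close> into the cosine matrices.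
\<close>

section \<open>Fourier series and Poisson summation\<close>

text \<open>Only odd frequencies occur because the sign (-1)^n is a character that moves the dual
  lattice by 1/2. Conversely, the character attached to an odd residue takes the value -1 at k, so
  the second summation restores the sign and stays inside the same family. The 4 in 4 \<tau> + 1
  makes the phase of the shift equal to exp(- pi i m^2 / (2 k)), which has period 2 k in m. The
  Gaussian transform is obtained from the normal distribution, hence only for real parameters. The
  identity theorem extends the two-parameter theta transformation, which then serves both
  summations. Each summation contributes a principal square root. Since \<open>csqrt\<close> is not
  multiplicative in general, merging the two into \<open>csqrt (4 * \<tau> + 1)\<close> needs an
  argument about half planes. In the constant 4 / k, each folding gives a factor 2 and the square
  roots give 1 / k. The entries 1/2 come from indices without a partner: the middle column of B_k
  for odd k and the first column of C_k.\<close>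

lemma trig_orthogonal_mult_polynomial:
  fixes q :: "complex \<Rightarrow> real" and h :: "real \<Rightarrow> complex"
  assumes "real_polynomial_function q" "continuous_on {0..1} h"
    and "\<And>l::int. integral {0..1} (\<lambda>x. h x * cis (2 * pi * l * x)) = 0"
  shows "integral {0..1} (\<lambda>x. h x * of_real (q (cis (2 * pi * x))) * cis (2 * pi * of_int l * x)) = 0"
  using assms
\<comment> \<open>Both \<open>h\<close> and \<open>l\<close> vary: multiplication by a linear form
  moves the frequency, and the product case absorbs one factor into \<open>h\<close>.\<close>
proof (induction arbitrary: h l rule: real_polynomial_function.induct)
  case (linear f h l)
  \<comment> \<open>On the unit circle a real linear form is a combination of z and 1/z. These are
    its coefficients, so multiplying by \<open>f\<close> shifts the frequency \<open>l\<close> by 1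
    in either direction.\<close>
  define \<alpha> \<beta> :: complex where "\<alpha> = (f 1 - \<i> * f \<i>) / 2" and "\<beta> = (f 1 + \<i> * f \<i>) / 2"
  have f: "f z = Re z * f 1 + Im z * f \<i>" for z
  proof -
    have "f z = f (Re z *\<^sub>R 1 + Im z *\<^sub>R \<i>)"
      by (rule arg_cong[where f = f]) (simp add: complex_eq_iff)
    also have "\<dots> = Re z * f 1 + Im z * f \<i>"
      using linear.hyps by (simp only: bounded_linear.linear linear_add linear_scale) simp
    finally show ?thesis .
  qed
  have eq: "h x * of_real (f (cis (2 * pi * x))) * cis (2 * pi * of_int l * x) =
      \<alpha> * (h x * cis (2 * pi * of_int (l + 1) * x)) + \<beta> * (h x * cis (2 * pi * of_int (l - 1) * x))" for x
  proof -
    have "of_real (f (cis (2 * pi * x))) = \<alpha> * cis (2 * pi * x) + \<beta> * cis (- (2 * pi * x))"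
      unfolding \<alpha>_def \<beta>_def by (subst f) (simp add: complex_eq_iff field_simps)
    moreover have "cis (2 * pi * of_int (l + 1) * x) = cis (2 * pi * x) * cis (2 * pi * of_int l * x)"
      "cis (2 * pi * of_int (l - 1) * x) = cis (- (2 * pi * x)) * cis (2 * pi * of_int l * x)"
      by (simp_all add: cis_mult algebra_simps)
    ultimately show ?thesis
      by (simp add: algebra_simps)
  qed
  have int: "(\<lambda>x. h x * cis (2 * pi * of_int m * x)) integrable_on {0..1}" for m
    using linear.prems(1) by (intro integrable_continuous_real continuous_intros)
  show ?case
    unfolding eq
    by (subst Henstock_Kurzweil_Integration.integral_add) (auto intro!: int integrable_on_mult_right simp: linear.prems(2) simp del: of_int_add of_int_diff)
next
  case (const c h l)
  have "(\<lambda>x. h x * of_real c * cis (2 * pi * of_int l * x)) = (\<lambda>x. of_real c * (h x * cis (2 * pi * of_int l * x)))"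
    by (auto simp: fun_eq_iff)
  then show ?case
    using const by simp
next
  case (add f g h l)
  have cont: "continuous_on {0..1} (\<lambda>x. p (cis (2 * pi * x)))" if "real_polynomial_function p" for p
    by (intro continuous_intros continuous_on_compose2[OF continuous_on_polymonial_function
          [OF that[unfolded real_polynomial_function_eq], where S = UNIV]]) auto
  have int: "(\<lambda>x. h x * of_real (p (cis (2 * pi * x))) * cis (2 * pi * of_int m * x)) integrable_on {0..1}"
    if "real_polynomial_function p" for p m
    using add.prems(1) cont[OF that] by (intro integrable_continuous_real continuous_intros)
  show ?case
    using add.IH[OF add.prems] add.hyps
    by (simp add: ring_distribs Henstock_Kurzweil_Integration.integral_add int)
next
  case (mult f g h l)
  have cont: "continuous_on {0..1} (\<lambda>x. f (cis (2 * pi * x)))"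
    by (intro continuous_intros continuous_on_compose2[OF continuous_on_polymonial_function
          [OF mult.hyps(1)[unfolded real_polynomial_function_eq], where S = UNIV]]) auto
  have "continuous_on {0..1} (\<lambda>x. h x * of_real (f (cis (2 * pi * x))))"
    using mult.prems cont by (intro continuous_intros)
  \<comment> \<open>The first hypothesis says that h times f again has no Fourier coefficients, so
    the second applies with this product in the place of \<open>h\<close>.\<close>
  from mult.IH(2)[OF this mult.IH(1)[OF mult.prems]] show ?case
    by (simp add: mult_ac)
qed

lemma fourier_coefficients_zero_imp_zero:
  fixes h :: "real \<Rightarrow> complex"
  assumes cont: "continuous_on {0..1} h" and per: "h 0 = h 1"
    and orth: "\<And>l::int. integral {0..1} (\<lambda>x. h x * cis (2 * pi * l * x)) = 0"
    and x: "x \<in> {0..1}"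
  shows "h x = 0"
proof -
  define g where "g = (\<lambda>z. cnj (h (Arg2pi z / (2 * pi))))"
  \<comment> \<open>The constant homotopy is a detour to the fact that a closed loop descends to a
    continuous map on the circle. This gives continuity across the cut of \<open>Arg2pi\<close>,
    where \<open>h 0 = h 1\<close> matters.\<close>
  have "homotopic_loops UNIV h h"
    using cont per by (simp add: homotopic_loops_refl path_def pathstart_def pathfinish_def)
  then have "continuous_on (sphere 0 1) (h \<circ> (\<lambda>z. Arg2pi z / (2 * pi)))"
    using homotopic_loops_imp_homotopic_circlemaps homotopic_with_imp_continuous by blast
  then have g: "continuous_on (sphere 0 1) g"
    unfolding g_def o_def by (intro continuous_intros)
  have g_cis: "g (cis (2 * pi * t)) = cnj (h t)" if "t \<in> {0..1}" for t
  proof (cases "t = 1")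
    case True
    then have "cis (2 * pi * t) = 1" by simp
    moreover have "Arg2pi 1 = 0"
      using Arg2pi_eq_0 by simp
    ultimately show ?thesis
      using per True by (simp add: g_def)
  next
    case False
    have "Arg2pi (cis (2 * pi * t)) = 2 * pi * t"
      using that False by (intro Arg2pi_unique[of 1]) (auto simp: cis_conv_exp)
    then show ?thesis by (simp add: g_def)
  qed
  define J where "J = integral {0..1} (\<lambda>t. (norm (h t))\<^sup>2)"
  define M where "M = integral {0..1} (\<lambda>t. norm (h t))"
  have nonneg: "0 \<le> M"
    unfolding M_def by (intro integral_nonneg integrable_continuous_real continuous_intros cont) auto
  \<comment> \<open>\<open>h\<close> is orthogonal to every polynomial \<open>p\<close> on the circle, so \<open>J\<close> is the integral of
    \<open>h (cnj h - p)\<close>, and \<open>p\<close> can be chosen within \<open>e\<close> of \<open>cnj h\<close>.\<close>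
  have J: "J \<le> e * M" if e: "e > 0" for e
  proof -
    obtain p where p: "polynomial_function p" "\<forall>z\<in>sphere 0 1. norm (g z - p z) < e"
      using Stone_Weierstrass_polynomial_function[OF compact_sphere g e] by blast
    have re: "real_polynomial_function (\<lambda>z. Re (p z))" and im: "real_polynomial_function (\<lambda>z. Im (p z))"
      using p(1) bounded_linear_Re bounded_linear_Im unfolding polynomial_function_def o_def by blast+
    have zero: "integral {0..1} (\<lambda>t. h t * of_real (q (cis (2 * pi * t)))) = 0"
      if "real_polynomial_function q" for q
      using trig_orthogonal_mult_polynomial[OF that cont orth, of 0] by simp
    have cont_p: "continuous_on {0..1} (\<lambda>t. q (cis (2 * pi * t)))" if "real_polynomial_function q" for q
      by (intro continuous_intros continuous_on_compose2[OF continuous_on_polymonial_function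
            [OF that[unfolded real_polynomial_function_eq], where S = UNIV]]) auto
    have cp: "continuous_on {0..1} (\<lambda>t. p (cis (2 * pi * t)))"
      by (intro continuous_intros
          continuous_on_compose2[OF continuous_on_polymonial_function[OF p(1), where S = UNIV]]) auto
    have "integral {0..1} (\<lambda>t. h t * p (cis (2 * pi * t))) =
        integral {0..1} (\<lambda>t. h t * of_real (Re (p (cis (2 * pi * t)))) + \<i> * (h t * of_real (Im (p (cis (2 * pi * t))))))"
    proof (intro arg_cong[where f = "integral _"] ext)
      fix t :: real
      have "h t * z = h t * of_real (Re z) + \<i> * (h t * of_real (Im z))" for z
        by (subst complex_eq) (simp add: algebra_simps)
      then show "h t * p (cis (2 * pi * t)) = h t * of_real (Re (p (cis (2 * pi * t)))) + \<i> * (h t * of_real (Im (p (cis (2 * pi * t)))))" .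
    qed
    also have "\<dots> = 0"
      using cont_p[OF re] cont_p[OF im] cont
      by (subst Henstock_Kurzweil_Integration.integral_add)
         (auto intro!: integrable_continuous_real continuous_intros simp: zero[OF re] zero[OF im])
    finally have hp: "integral {0..1} (\<lambda>t. h t * p (cis (2 * pi * t))) = 0" .
    have "of_real J = integral {0..1} (\<lambda>t. h t * cnj (h t))"
      using integral_linear[OF integrable_continuous_real bounded_linear_of_real[where ?'a = complex],
          of 0 1 "\<lambda>t. (norm (h t))\<^sup>2"] cont
      by (simp add: J_def o_def complex_norm_square continuous_intros del: of_real_power)
    also have "\<dots> = integral {0..1} (\<lambda>t. h t * (cnj (h t) - p (cis (2 * pi * t))))"
      using hp cont cp
      by (simp add: algebra_simps, subst Henstock_Kurzweil_Integration.integral_diff)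
         (auto intro!: integrable_continuous_real continuous_intros)
    finally have "\<bar>J\<bar> = norm (integral {0..1} (\<lambda>t. h t * (cnj (h t) - p (cis (2 * pi * t)))))"
      using norm_of_real[of J, where ?'a = complex] by simp
    also have "\<dots> \<le> integral {0..1} (\<lambda>t. e * norm (h t))"
    proof (intro integral_norm_bound_integral)
      fix t :: real assume t: "t \<in> {0..1}"
      have "norm (cnj (h t) - p (cis (2 * pi * t))) \<le> e"
        using p(2)[rule_format, of "cis (2 * pi * t)"] g_cis[OF t] by simp
      then show "norm (h t * (cnj (h t) - p (cis (2 * pi * t)))) \<le> e * norm (h t)"
        unfolding norm_mult by (metis mult.commute mult_right_mono norm_ge_zero)
    qed (intro integrable_continuous_real continuous_intros cont cp)+
    also have "\<dots> = e * M"
      by (simp add: M_def)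
    finally show ?thesis by simp
  qed
  \<comment> \<open>The tolerance 1 / (n (M + 1)) is used, with M + 1 instead of M because M may be
    0.\<close>
  have "J \<le> 1 / real n" if "n > 0" for n
  proof -
    have "1 / (real n * (M + 1)) * M \<le> 1 / real n"
      using nonneg that by (simp add: divide_simps)
    moreover have "1 / (real n * (M + 1)) > 0"
      using nonneg that by simp
    ultimately show ?thesis
      using J order_trans by blast
  qed
  then have "J \<le> 0"
    by (intro LIMSEQ_le_const[OF lim_1_over_n] exI[of _ 1]) auto
  moreover have "0 \<le> J"
    unfolding J_def by (intro integral_nonneg integrable_continuous_real continuous_intros cont) auto
  ultimately have "J = 0" by simp
  then have "\<forall>t\<in>{0..1}. (norm (h t))\<^sup>2 = 0"
    unfolding J_def using cont
    by (subst (asm) integral_eq_0_iff) (auto intro!: continuous_intros)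
  then show ?thesis
    using x by auto
qed

text \<open>A single uniform limit along finite partial sums gives both continuity and termwise
  integration. The majorant makes the convergence unordered, so no enumeration of the index type is
  involved.\<close>

lemma
  fixes f :: "'i \<Rightarrow> real \<Rightarrow> complex" and M :: "'i \<Rightarrow> real"
  assumes bound: "\<And>n x. x \<in> {a..b} \<Longrightarrow> norm (f n x) \<le> M n" and M: "M summable_on UNIV"
    and cont: "\<And>n. continuous_on {a..b} (f n)"
  shows continuous_on_infsum_M_test: "continuous_on {a..b} (\<lambda>x. \<Sum>\<^sub>\<infinity>n. f n x)"
    and has_sum_integral_M_test:
      "((\<lambda>n. integral {a..b} (f n)) has_sum integral {a..b} (\<lambda>x. \<Sum>\<^sub>\<infinity>n. f n x)) UNIV"
proof -
  have ulim: "uniform_limit {a..b} (\<lambda>A x. \<Sum>n\<in>A. f n x) (\<lambda>x. \<Sum>\<^sub>\<infinity>n. f n x) (finite_subsets_at_top UNIV)"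
    using bound M by (intro Weierstrass_m_test_general) auto
  have cont_sum: "continuous_on {a..b} (\<lambda>x. \<Sum>n\<in>A. f n x)" for A
    by (intro continuous_intros cont)
  show "continuous_on {a..b} (\<lambda>x. \<Sum>\<^sub>\<infinity>n. f n x)"
    by (intro uniform_limit_theorem[OF _ ulim] always_eventually allI cont_sum) auto
  from uniform_limit_integral[OF ulim cont_sum] obtain I J where
    I: "\<And>A. ((\<lambda>x. \<Sum>n\<in>A. f n x) has_integral I A) {a..b}"
    and J: "((\<lambda>x. \<Sum>\<^sub>\<infinity>n. f n x) has_integral J) {a..b}"
    and lim: "(I \<longlongrightarrow> J) (finite_subsets_at_top UNIV)"
    by auto
  have "I A = (\<Sum>n\<in>A. integral {a..b} (f n))" if "finite A" for A
    using I[of A] that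
    by (subst Henstock_Kurzweil_Integration.integral_sum[symmetric])
      (auto intro!: integrable_continuous_real cont simp: integral_unique)
  then have "((\<lambda>A. \<Sum>n\<in>A. integral {a..b} (f n)) \<longlongrightarrow> J) (finite_subsets_at_top UNIV)"
    by (intro Lim_transform_eventually[OF lim]) (auto intro!: eventually_finite_subsets_at_top_weakI)
  then show "((\<lambda>n. integral {a..b} (f n)) has_sum integral {a..b} (\<lambda>x. \<Sum>\<^sub>\<infinity>n. f n x)) UNIV"
    using J by (simp add: has_sum_def integral_unique)
qed

lemma integral_cis_int:
  "integral {0..1} (\<lambda>x. cis (2 * pi * of_int l * x)) = (if l = 0 then 1 else 0)"
proof (cases "l = 0")
  case False
  define \<omega> where "\<omega> = 2 * complex_of_real pi * of_int l * \<i>"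
  have "\<omega> \<noteq> 0" using False by (simp add: \<omega>_def)
  have cis: "cis (2 * pi * of_int l * x) = exp (\<omega> * of_real x)" for x
    by (simp add: cis_conv_exp \<omega>_def mult_ac)
  have "((\<lambda>x. exp (\<omega> * of_real x)) has_integral
      (exp (\<omega> * of_real 1) / \<omega> - exp (\<omega> * of_real 0) / \<omega>)) {0..1}"
    using \<open>\<omega> \<noteq> 0\<close>
    by (intro fundamental_theorem_of_calculus
          has_vector_derivative_real_field[where f = "\<lambda>z. exp (\<omega> * z) / \<omega>"])
      (auto intro!: derivative_eq_intros)
  moreover have "exp (\<omega> * of_real 1) = 1"
    unfolding cis[symmetric] by (simp add: cis_multiple_2pi)
  ultimately show ?thesis
    using False by (simp add: cis integral_unique)
qed simp

text \<open>Summable coefficients make the series converge uniformly to a continuous function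
  \<open>g\<close>, which termwise integration shows to have the same coefficients as
  \<open>h\<close>. By uniqueness h - g vanishes, so no smoothness of \<open>h\<close> enters beyond
  the summability.\<close>

lemma fourier_series_has_sum:
  fixes h :: "real \<Rightarrow> complex" and c :: "int \<Rightarrow> complex"
  assumes cont: "continuous_on {0..1} h" and per: "h 0 = h 1"
    and coeff: "\<And>l. integral {0..1} (\<lambda>x. h x * cis (2 * pi * of_int (- l) * x)) = c l"
    and summable: "(\<lambda>l. norm (c l)) summable_on UNIV"
    and x: "x \<in> {0..1}"
  shows "((\<lambda>l. c l * cis (2 * pi * of_int l * x)) has_sum h x) UNIV"
proof -
  define g where "g = (\<lambda>x. \<Sum>\<^sub>\<infinity>l. c l * cis (2 * pi * of_int l * x))"
  have g: "continuous_on {0..1} g"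
    unfolding g_def
    by (rule continuous_on_infsum_M_test[OF _ summable]) (auto intro!: continuous_intros simp: norm_mult)
  have "integral {0..1} (\<lambda>x. g x * cis (2 * pi * of_int (- m) * x)) = c m" for m
  proof -
    have eq: "g x * cis (2 * pi * of_int (- m) * x) = (\<Sum>\<^sub>\<infinity>l. c l * cis (2 * pi * of_int (l - m) * x))" for x
      unfolding g_def by (subst infsum_cmult_left'[symmetric]) (simp add: cis_mult mult.assoc algebra_simps)
    have "((\<lambda>l. integral {0..1} (\<lambda>x. c l * cis (2 * pi * of_int (l - m) * x))) has_sum
        integral {0..1} (\<lambda>x. g x * cis (2 * pi * of_int (- m) * x))) UNIV"
      unfolding eq
      by (rule has_sum_integral_M_test[OF _ summable]) (auto intro!: continuous_intros simp: norm_mult)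
    then have "((\<lambda>l. c l * (if l = m then 1 else 0)) has_sum
        integral {0..1} (\<lambda>x. g x * cis (2 * pi * of_int (- m) * x))) UNIV"
      by (simp only: integral_mult_right integral_cis_int) simp
    moreover have "((\<lambda>l. c l * (if l = m then 1 else 0)) has_sum c m) UNIV"
      by (rule has_sum_finite_neutralI[of "{m}"]) auto
    ultimately show ?thesis
      using has_sum_unique by blast
  qed
  note g_coeff = this
  have "h x - g x = 0"
  proof (rule fourier_coefficients_zero_imp_zero[OF _ _ _ x, of "\<lambda>x. h x - g x"])
    show "integral {0..1} (\<lambda>x. (h x - g x) * cis (2 * pi * of_int l * x)) = 0" for l
    proof -
      have "integral {0..1} (\<lambda>x. (h x - g x) * cis (2 * pi * of_int l * x)) =
          integral {0..1} (\<lambda>x. h x * cis (2 * pi * of_int (- (- l)) * x)) -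
          integral {0..1} (\<lambda>x. g x * cis (2 * pi * of_int (- (- l)) * x))"
        by (subst Henstock_Kurzweil_Integration.integral_diff[symmetric])
          (auto intro!: integrable_continuous_real continuous_intros cont g simp: algebra_simps)
      then show ?thesis
        by (simp only: coeff g_coeff) simp
    qed
    show "h 0 - g 0 = h 1 - g 1"
      by (simp add: per g_def cis_multiple_2pi)
  qed (intro continuous_intros cont g)
  moreover have "((\<lambda>l. c l * cis (2 * pi * of_int l * x)) has_sum g x) UNIV"
    unfolding g_def
    by (rule has_sum_infsum[OF abs_summable_summable]) (simp add: norm_mult summable)
  ultimately show ?thesis by simp
qed

text \<open>The periodization of \<open>f\<close> has the Fourier transform at the integers as its
  Fourier coefficients, and its Fourier series is evaluated at 0. The majorant \<open>M\<close>
  makes the periodization uniformly convergent on the unit interval.\<close>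

lemma poisson_summation:
  fixes f :: "real \<Rightarrow> complex" and M :: "int \<Rightarrow> real"
  assumes cont: "continuous_on UNIV f" and int: "integrable lborel f"
    and bound: "\<And>n x. x \<in> {0..1} \<Longrightarrow> norm (f (of_int n + x)) \<le> M n" and M: "M summable_on UNIV"
    and coeff: "\<And>l::int. (LINT x|lborel. f x * cis (2 * pi * of_int (- l) * x)) = c l"
    and summable: "(\<lambda>l. norm (c l)) summable_on UNIV"
  shows "(\<Sum>\<^sub>\<infinity>n. f (of_int n)) = (\<Sum>\<^sub>\<infinity>l. c l)"
proof -
  define h where "h = (\<lambda>x. \<Sum>\<^sub>\<infinity>n::int. f (of_int n + x))"
  have cont': "continuous_on A f" for A
    using cont continuous_on_subset by blast
  have cont_shift: "continuous_on A (\<lambda>x. f (of_int n + x))" for A n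
    by (intro continuous_on_compose2[OF cont] continuous_intros) auto
  have "continuous_on {0..1} h"
    unfolding h_def by (rule continuous_on_infsum_M_test[OF bound M cont_shift])
  moreover have "h 0 = h 1"
  proof -
    have "h 1 = (\<Sum>\<^sub>\<infinity>n\<in>UNIV. f (of_int (n + 1)))" by (simp add: h_def)
    also have "\<dots> = (\<Sum>\<^sub>\<infinity>n\<in>UNIV. f (of_int n))"
      by (rule infsum_reindex_bij_witness[of _ "\<lambda>n. n - 1" "\<lambda>n. n + 1"]) auto
    finally show ?thesis by (simp add: h_def)
  qed
  moreover have "integral {0..1} (\<lambda>x. h x * cis (2 * pi * of_int (- l) * x)) = c l" for l
  proof -
    define e where "e = (\<lambda>x. f x * cis (2 * pi * of_int (- l) * x))"
    have e_cont: "continuous_on A e" for A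
      unfolding e_def by (intro continuous_intros cont')
    have e_int: "integrable lborel e"
      unfolding e_def using cont
      by (intro Bochner_Integration.integrable_bound[OF int])
        (auto intro!: borel_measurable_continuous_onI continuous_intros simp: norm_mult)
    have e_shift: "f (of_int n + x) * cis (2 * pi * of_int (- l) * x) = e (x + of_int n)" for n x
    proof -
      have "cis (2 * pi * of_int (- l) * (x + of_int n)) =
          cis (2 * pi * of_int (- l) * x) * cis (2 * pi * of_int (- l * n))"
        by (simp add: cis_mult algebra_simps)
      also have "cis (2 * pi * of_int (- l * n)) = 1"
        by (rule cis_multiple_2pi) (rule Ints_of_int)
      finally show ?thesis
        unfolding e_def by (simp only: add.commute mult_1_right)
    qed
    have eq: "h x * cis (2 * pi * of_int (- l) * x) = (\<Sum>\<^sub>\<infinity>n::int. e (x + of_int n))" for x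
      unfolding h_def e_shift[symmetric] by (rule infsum_cmult_left'[symmetric])
    have "((\<lambda>n::int. integral {0..1} (\<lambda>x. e (x + of_int n))) has_sum
        integral {0..1} (\<lambda>x. h x * cis (2 * pi * of_int (- l) * x))) UNIV"
      unfolding eq using bound
      by (intro has_sum_integral_M_test[OF _ M] continuous_on_compose2[OF e_cont[of UNIV]] continuous_intros)
        (auto simp: e_shift[symmetric] norm_mult)
    moreover have "integral {0..1} (\<lambda>x. e (x + of_int n)) = integral {of_int n..of_int n + 1} e" for n
      using integral_shift_real_ivl[of "of_int n" "of_int n" "of_int n + 1" e] by simp
    ultimately have sum: "((\<lambda>n::int. integral {of_int n..of_int n + 1} e) has_sum
        integral {0..1} (\<lambda>x. h x * cis (2 * pi * of_int (- l) * x))) UNIV"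
      by simp
    \<comment> \<open>The unordered sum over unit intervals is read along a cofinal sequence of
      blocks. Their union is the interval from -N to N, so dominated convergence can identify the
      limit with the integral over the line.\<close>
    have "filterlim (\<lambda>N. {- int N..<int N}) (finite_subsets_at_top UNIV) sequentially"
    proof (rule filterlim_finite_subsets_at_top[THEN iffD2], safe)
      fix X :: "int set" assume X: "finite X"
      define B where "B = (\<Sum>x\<in>X. nat \<bar>x\<bar> + 1)"
      have "nat \<bar>x\<bar> + 1 \<le> B" if "x \<in> X" for x
        unfolding B_def using X that by (intro member_le_sum) auto
      then have "\<bar>x\<bar> < int B" if "x \<in> X" for x
        using that by fastforce
      then show "\<forall>\<^sub>F N in sequentially. finite {- int N..<int N} \<and> X \<subseteq> {- int N..<int N} \<and> {- int N..<int N} \<subseteq> UNIV"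
        by (intro eventually_sequentiallyI[of B]) force
    qed
    from filterlim_compose[OF sum[unfolded has_sum_def] this]
    have lim1: "(\<lambda>N. \<Sum>n\<in>{- int N..<int N}. integral {of_int n..of_int n + 1} e)
        \<longlonglongrightarrow> integral {0..1} (\<lambda>x. h x * cis (2 * pi * of_int (- l) * x))" .
    have "(\<Sum>n\<in>{- int N..<int N}. integral {of_int n..of_int n + 1} e) = integral {- real N..real N} e" for N
    proof (induction N)
      case (Suc N)
      have "{- int (Suc N)..<int (Suc N)} = insert (- int (Suc N)) (insert (int N) {- int N..<int N})"
        by auto
      then have "(\<Sum>n\<in>{- int (Suc N)..<int (Suc N)}. integral {of_int n..of_int n + 1} e) =
          integral {- real (Suc N)..- real N} e + (integral {real N..real (Suc N)} e + integral {- real N..real N} e)"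
        using Suc.IH by (simp add: algebra_simps)
      also have "\<dots> = integral {- real (Suc N)..- real N} e + integral {- real N..real (Suc N)} e"
        using Henstock_Kurzweil_Integration.integral_combine[of "- real N" "real N" "real (Suc N)" e]
        by (simp add: integrable_continuous_real[OF e_cont] add.commute)
      also have "\<dots> = integral {- real (Suc N)..real (Suc N)} e"
        by (intro Henstock_Kurzweil_Integration.integral_combine integrable_continuous_real e_cont) auto
      finally show ?case .
    qed simp
    moreover have "integral {- real N..real N} e = (LINT x|lborel. indicator {- real N..real N} x *\<^sub>R e x)" for N
      using set_borel_integral_eq_integral(2)[of "{- real N..real N}" e]
        borel_integrable_atLeastAtMost'[OF e_cont]
      by (simp add: set_lebesgue_integral_def)
    moreover have "(\<lambda>N. LINT x|lborel. indicator {- real N..real N} x *\<^sub>R e x) \<longlonglongrightarrow> (LINT x|lborel. e x)"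
    proof (rule integral_dominated_convergence[where w = "\<lambda>x. norm (e x)"])
      show "AE x in lborel. (\<lambda>N. indicator {- real N..real N} x *\<^sub>R e x) \<longlonglongrightarrow> e x"
      proof (intro AE_I2 tendsto_eventually)
        fix x :: real
        show "\<forall>\<^sub>F N in sequentially. indicator {- real N..real N} x *\<^sub>R e x = e x"
          by (intro eventually_sequentiallyI[of "nat \<lceil>\<bar>x\<bar>\<rceil>"]) (auto simp: indicator_def)
      qed
    qed (use e_int in \<open>auto simp: indicator_def\<close>)
    ultimately show ?thesis
      using lim1 coeff[of l] LIMSEQ_unique unfolding e_def by auto
  qed
  ultimately have "((\<lambda>l. c l * cis (2 * pi * of_int l * 0)) has_sum h 0) UNIV"
    using summable by (intro fourier_series_has_sum) auto
  then show ?thesis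
    by (simp add: h_def infsumI)
qed

section \<open>Gaussian sums over the integers\<close>

text \<open>The substitution of c (x + a) with c^2 = 2 pi s turns the Gaussian into sqrt (2 pi)
  times the standard normal density, whose characteristic function at u / c is exp (- u^2 / (4 pi
  s)). The shift by \<open>a\<close> leaves the factor \<open>cis (- (u * a))\<close>.\<close>

lemma gaussian_fourier_transform:
  fixes s u a :: real
  assumes "s > 0"
  shows "integrable lborel (\<lambda>x. exp (- pi * s * (x + a)\<^sup>2) *\<^sub>R cis (u * x))" (is ?I)
    and "(LINT x|lborel. exp (- pi * s * (x + a)\<^sup>2) *\<^sub>R cis (u * x)) =
           (exp (- u\<^sup>2 / (4 * pi * s)) / sqrt s) *\<^sub>R cis (- (u * a))" (is ?L)
proof -
  define c where "c = sqrt (2 * pi * s)"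
  have c: "c > 0" "c\<^sup>2 = 2 * pi * s"
    using assms by (simp_all add: c_def)
  define g :: "real \<Rightarrow> complex" where "g = (\<lambda>x. std_normal_density x *\<^sub>R cis (u / c * x))"
  have "integrable lborel (normal_density 0 1)"
    by (rule integrable_normal_density) simp
  then have g_int: "integrable lborel g"
  proof (rule Bochner_Integration.integrable_bound)
    have [measurable]: "(\<lambda>x. cis (u / c * x)) \<in> borel_measurable borel"
      by (intro borel_measurable_continuous_onI continuous_intros)
    show "g \<in> borel_measurable lborel"
      unfolding g_def by measurable
  qed (simp add: g_def normal_density_nonneg)
  have "(LINT x|lborel. g x) = char std_normal_distribution (u / c)"
    unfolding char_def g_def
    by (subst integral_density) (auto simp: normal_density_nonneg cis_conv_exp mult_ac intro!: Bochner_Integration.integral_cong)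
  also have "\<dots> = exp (- u\<^sup>2 / (4 * pi * s))"
    by (simp add: char_std_normal_distribution power_divide c field_simps)
  finally have g_lint: "(LINT x|lborel. g x) = exp (- u\<^sup>2 / (4 * pi * s))" .
  have eq: "exp (- pi * s * (x + a)\<^sup>2) *\<^sub>R cis (u * x) =
      (sqrt (2 * pi) *\<^sub>R cis (- (u * a))) * g (c * a + c * x)" for x
  proof -
    have "(c * a + c * x)\<^sup>2 = c\<^sup>2 * (x + a)\<^sup>2"
      by (simp add: power2_eq_square algebra_simps)
    then have "exp (- pi * s * (x + a)\<^sup>2) = sqrt (2 * pi) * std_normal_density (c * a + c * x)"
      by (simp add: std_normal_density_def c)
    moreover have "u / c * (c * a + c * x) = u * a + u * x"
      using c by (simp add: field_simps)
    ultimately show ?thesis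
      by (simp add: g_def cis_mult scaleR_conv_of_real mult_ac)
  qed
  show ?I
    unfolding eq using lborel_integrable_real_affine[OF g_int, of c "c * a"] c by simp
  show ?L
    unfolding eq using lborel_integral_real_affine[of c g "c * a"] c(1) assms
    by (simp add: g_lint c_def scaleR_conv_of_real real_sqrt_mult field_simps)
qed

text \<open>Since (n + x)^2 - n^2 / 2 + x^2 is half the square of n + 2 x, and n^2 is at least |n|
  for integers, the exponent is bounded below linearly in |n|. The bound is uniform in x, as the
  M-test requires.\<close>

lemma gaussian_le_geometric:
  fixes \<delta> x R :: real and n :: int
  assumes "\<delta> > 0" "\<bar>x\<bar> \<le> R"
  shows "exp (- \<delta> * (of_int n + x)\<^sup>2) \<le> exp (\<delta> * R\<^sup>2) * exp (- \<delta> / 2) ^ nat \<bar>n\<bar>"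
proof -
  have "\<bar>n\<bar> \<le> n\<^sup>2"
    using self_le_power[of "\<bar>n\<bar>" 2] by (cases "n = 0") auto
  then have n: "real_of_int \<bar>n\<bar> \<le> (of_int n)\<^sup>2"
    by (metis of_int_le_iff of_int_power)
  have "x\<^sup>2 \<le> R\<^sup>2"
    using assms(2) by (simp add: abs_le_square_iff[symmetric])
  moreover have "(of_int n + x)\<^sup>2 - (of_int n)\<^sup>2 / 2 + x\<^sup>2 = (of_int n + 2 * x)\<^sup>2 / 2"
    by (simp add: power2_eq_square field_simps)
  then have "(of_int n)\<^sup>2 / 2 - x\<^sup>2 \<le> (of_int n + x)\<^sup>2"
    using zero_le_power2[of "of_int n + 2 * x"] by linarith
  ultimately have "real_of_int \<bar>n\<bar> / 2 - R\<^sup>2 \<le> (of_int n + x)\<^sup>2"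
    using n by linarith
  then have "\<delta> * (real_of_int \<bar>n\<bar> / 2 - R\<^sup>2) \<le> \<delta> * (of_int n + x)\<^sup>2"
    using assms(1) by simp
  then have "exp (- \<delta> * (of_int n + x)\<^sup>2) \<le> exp (\<delta> * R\<^sup>2 + real (nat \<bar>n\<bar>) * (- \<delta> / 2))"
    by (simp add: algebra_simps)
  then show ?thesis
    by (simp only: exp_add exp_of_nat_mult)
qed

lemma summable_on_power_abs_int:
  fixes r :: real
  assumes "0 \<le> r" "r < 1"
  shows "(\<lambda>n::int. r ^ nat \<bar>n\<bar>) summable_on UNIV"
proof -
  have geo: "(\<lambda>n. r ^ n) summable_on (UNIV :: nat set)"
    using assms by (intro norm_summable_imp_summable_on) simp
  have "(\<lambda>n::int. r ^ nat \<bar>n\<bar>) summable_on range int"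
    using geo by (subst summable_on_reindex) (auto simp: o_def)
  moreover have "(\<lambda>n::int. r ^ nat \<bar>n\<bar>) summable_on range (\<lambda>n. - int n)"
    using geo by (subst summable_on_reindex) (auto simp: o_def inj_on_def)
  moreover have "range int \<union> range (\<lambda>n. - int n) = UNIV"
    by (auto simp: image_iff) (metis int_cases2)
  ultimately show ?thesis
    using summable_on_union by metis
qed

lemma summable_on_gaussian:
  fixes \<delta> a :: real
  assumes "\<delta> > 0"
  shows "(\<lambda>n::int. exp (- \<delta> * (of_int n + a)\<^sup>2)) summable_on UNIV"
proof (rule summable_on_comparison_test)
  show "(\<lambda>n::int. exp (\<delta> * \<bar>a\<bar>\<^sup>2) * exp (- \<delta> / 2) ^ nat \<bar>n\<bar>) summable_on UNIV"
    using assms by (intro summable_on_cmult_right summable_on_power_abs_int) auto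
qed (use gaussian_le_geometric[OF assms, of a "\<bar>a\<bar>"] in auto)

text \<open>Poisson summation exchanges the shift \<open>a\<close> and the character
  \<open>b\<close>; keeping both allows b = 1/2 to encode the sign (-1)^n. The coefficient at l is
  the Gaussian transform at 2 pi (b - l), and the reflection of l turns b - l into n + b.\<close>

lemma theta_transformation_real:
  fixes s a b :: real
  assumes s: "s > 0"
  shows "(\<Sum>\<^sub>\<infinity>n::int. exp (- pi * s * (of_int n + a)\<^sup>2) *\<^sub>R cis (2 * pi * b * of_int n)) =
    (\<Sum>\<^sub>\<infinity>n::int. exp (- pi / s * (of_int n + b)\<^sup>2) *\<^sub>R cis (- (2 * pi * a * (of_int n + b)))) / sqrt s"
proof -
  define f :: "real \<Rightarrow> complex" where "f = (\<lambda>x. exp (- pi * s * (x + a)\<^sup>2) *\<^sub>R cis (2 * pi * b * x))"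
  define c :: "int \<Rightarrow> complex" where
    "c = (\<lambda>l. (exp (- pi / s * (of_int l - b)\<^sup>2) / sqrt s) *\<^sub>R cis (- (2 * pi * a * (b - of_int l))))"
  have "(\<Sum>\<^sub>\<infinity>n. f (of_int n)) = (\<Sum>\<^sub>\<infinity>l. c l)"
  proof (rule poisson_summation)
    show "continuous_on UNIV f"
      unfolding f_def by (intro continuous_intros)
    show "integrable lborel f"
      unfolding f_def by (rule gaussian_fourier_transform[OF s])
    show "norm (f (of_int n + x)) \<le> exp (pi * s * (1 + \<bar>a\<bar>)\<^sup>2) * exp (- (pi * s) / 2) ^ nat \<bar>n\<bar>"
      if "x \<in> {0..1}" for n :: int and x
    proof -
      have "\<bar>x + a\<bar> \<le> 1 + \<bar>a\<bar>"
        using that by auto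
      then show ?thesis
        using gaussian_le_geometric[of "pi * s" "x + a" "1 + \<bar>a\<bar>" n] s
        by (simp add: f_def add.assoc)
    qed
    show "(\<lambda>n::int. exp (pi * s * (1 + \<bar>a\<bar>)\<^sup>2) * exp (- (pi * s) / 2) ^ nat \<bar>n\<bar>) summable_on UNIV"
      using s by (intro summable_on_cmult_right summable_on_power_abs_int) auto
    show "(LINT x|lborel. f x * cis (2 * pi * of_int (- l) * x)) = c l" for l
    proof -
      have "f x * cis (2 * pi * of_int (- l) * x) =
          exp (- pi * s * (x + a)\<^sup>2) *\<^sub>R cis (2 * pi * (b - of_int l) * x)" for x
        by (simp add: f_def cis_mult algebra_simps)
      moreover have "(2 * pi * (b - of_int l))\<^sup>2 / (4 * pi * s) = pi / s * (of_int l - b)\<^sup>2"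
        using s by (simp add: field_simps power2_eq_square)
      ultimately show ?thesis
        using gaussian_fourier_transform(2)[OF s, of a "2 * pi * (b - of_int l)"]
        by (simp add: c_def mult_ac)
    qed
    have "(\<lambda>l. exp (- (pi / s) * (of_int l + (- b))\<^sup>2) * (1 / sqrt s)) summable_on UNIV"
      using s by (intro summable_on_cmult_left summable_on_gaussian) simp
    then show "(\<lambda>l. norm (c l)) summable_on UNIV"
      using s by (simp add: c_def)
  qed
  also have "(\<Sum>\<^sub>\<infinity>l. c l) = (\<Sum>\<^sub>\<infinity>l. c (- l))"
    by (rule infsum_reindex_bij_witness[of _ uminus uminus]) auto
  also have "\<dots> = (\<Sum>\<^sub>\<infinity>n::int. (exp (- pi / s * (of_int n + b)\<^sup>2) *\<^sub>R cis (- (2 * pi * a * (of_int n + b)))) * (1 / sqrt s))"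
  proof (rule infsum_cong)
    fix l :: int
    have "(of_int (- l) - b)\<^sup>2 = (of_int l + b)\<^sup>2"
      by (simp add: power2_eq_square algebra_simps)
    then show "c (- l) = (exp (- pi / s * (of_int l + b)\<^sup>2) *\<^sub>R cis (- (2 * pi * a * (of_int l + b)))) * (1 / sqrt s)"
      by (simp add: c_def scaleR_conv_of_real add.commute)
  qed
  also have "\<dots> = (\<Sum>\<^sub>\<infinity>n::int. exp (- pi / s * (of_int n + b)\<^sup>2) *\<^sub>R cis (- (2 * pi * a * (of_int n + b)))) * (1 / sqrt s)"
    by (rule infsum_cmult_left')
  finally show ?thesis
    by (simp add: f_def)
qed

text \<open>On the closed disc of radius Re z / 2 around z, real parts are at least Re z / 2, so one
  real Gaussian series dominates all the others and the convergence is locally uniform.\<close>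

lemma holomorphic_gaussian_series:
  fixes c :: "int \<Rightarrow> complex" and a :: real
  assumes c: "\<And>n. norm (c n) \<le> 1"
  shows "(\<lambda>s. \<Sum>\<^sub>\<infinity>n. c n * exp (- of_real pi * s * (of_int n + of_real a)\<^sup>2)) holomorphic_on {s. Re s > 0}"
proof (rule analytic_imp_holomorphic, unfold analytic_on_def, rule ballI)
  fix z :: complex assume "z \<in> {s. Re s > 0}"
  define r where "r = Re z / 2"
  have r: "r > 0" using \<open>z \<in> _\<close> by (simp add: r_def)
  have Re: "Re w \<ge> r" if "w \<in> cball z r" for w
    using abs_Re_le_cmod[of "z - w"] that by (auto simp: r_def dist_norm)
  have bound: "norm (c n * exp (- of_real pi * w * (of_int n + of_real a)\<^sup>2)) \<le> exp (- (pi * r) * (of_int n + a)\<^sup>2)"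
    if "w \<in> cball z r" for n w
  proof -
    have "(of_int n + of_real a)\<^sup>2 = complex_of_real ((of_int n + a)\<^sup>2)"
      by simp
    then have "norm (exp (- of_real pi * w * (of_int n + of_real a)\<^sup>2)) = exp (- pi * Re w * (of_int n + a)\<^sup>2)"
      by (simp del: of_real_power)
    also have "\<dots> \<le> exp (- (pi * r) * (of_int n + a)\<^sup>2)"
      using Re[OF that] by (auto intro!: mult_right_mono)
    finally have "norm (exp (- of_real pi * w * (of_int n + of_real a)\<^sup>2)) \<le> exp (- (pi * r) * (of_int n + a)\<^sup>2)" .
    from mult_mono[OF c this] show ?thesis
      by (simp add: norm_mult)
  qed
  have "uniform_limit (cball z r) (\<lambda>A s. \<Sum>n\<in>A. c n * exp (- of_real pi * s * (of_int n + of_real a)\<^sup>2))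
      (\<lambda>s. \<Sum>\<^sub>\<infinity>n. c n * exp (- of_real pi * s * (of_int n + of_real a)\<^sup>2)) (finite_subsets_at_top UNIV)"
    using r by (intro Weierstrass_m_test_general[OF bound] summable_on_gaussian) auto
  then have "(\<lambda>s. \<Sum>\<^sub>\<infinity>n. c n * exp (- of_real pi * s * (of_int n + of_real a)\<^sup>2)) holomorphic_on ball z r"
    by (rule holomorphic_uniform_limit[rotated])
      (auto intro!: always_eventually continuous_intros holomorphic_intros)
  then show "\<exists>e>0. (\<lambda>s. \<Sum>\<^sub>\<infinity>n. c n * exp (- of_real pi * s * (of_int n + of_real a)\<^sup>2)) holomorphic_on ball z e"
    using r by blast
qed

text \<open>Both sides are holomorphic on the right half plane, which avoids the branch cut of
  \<open>csqrt\<close>. They agree on the positive reals, which accumulate at the interior point 1,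
  so the identity theorem applies.\<close>

theorem theta_transformation:
  fixes s :: complex and a b :: real
  assumes s: "Re s > 0"
  shows "(\<Sum>\<^sub>\<infinity>n::int. cis (2 * pi * b * of_int n) * exp (- of_real pi * s * (of_int n + of_real a)\<^sup>2)) =
    (\<Sum>\<^sub>\<infinity>n::int. cis (- (2 * pi * a * (of_int n + b))) * exp (- of_real pi * (1 / s) * (of_int n + of_real b)\<^sup>2)) / csqrt s"
proof -
  define L R where
    "L = (\<lambda>s. \<Sum>\<^sub>\<infinity>n::int. cis (2 * pi * b * of_int n) * exp (- of_real pi * s * (of_int n + of_real a)\<^sup>2))" and
    "R = (\<lambda>s. \<Sum>\<^sub>\<infinity>n::int. cis (- (2 * pi * a * (of_int n + b))) * exp (- of_real pi * s * (of_int n + of_real b)\<^sup>2))"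
  have L: "L holomorphic_on {s. Re s > 0}" and R: "R holomorphic_on {s. Re s > 0}"
    unfolding L_def R_def by (rule holomorphic_gaussian_series; simp)+
  have nonpos: "x \<notin> \<real>\<^sub>\<le>\<^sub>0" and nz: "x \<noteq> 0" if "Re x > 0" for x
    using that by (auto simp: complex_nonpos_Reals_iff)
  have "(R \<circ> (\<lambda>s. 1 / s)) holomorphic_on {s. Re s > 0}"
  proof (rule holomorphic_on_compose_gen[OF _ R])
    show "(\<lambda>s. 1 / s) ` {s. Re s > 0} \<subseteq> {s. Re s > 0}"
      using nz by (auto simp: Re_divide complex_eq_iff intro!: divide_pos_pos add_pos_nonneg)
  qed (auto intro!: holomorphic_intros dest: nz)
  then have hol: "(\<lambda>s. L s - R (1 / s) / csqrt s) holomorphic_on {s. Re s > 0}"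
    using L nonpos nz unfolding o_def by (intro holomorphic_intros) auto
  have zero: "L z - R (1 / z) / csqrt z = 0" if z: "z \<in> of_real ` {0<..}" for z
  proof -
    obtain t where t: "t > 0" "z = of_real t"
      using z by auto
    have "L z = (\<Sum>\<^sub>\<infinity>n::int. exp (- pi * t * (of_int n + a)\<^sup>2) *\<^sub>R cis (2 * pi * b * of_int n))"
      unfolding L_def t by (intro infsum_cong) (simp add: scaleR_conv_of_real mult_ac flip: exp_of_real)
    moreover have "R (1 / z) = (\<Sum>\<^sub>\<infinity>n::int. exp (- pi / t * (of_int n + b)\<^sup>2) *\<^sub>R cis (- (2 * pi * a * (of_int n + b))))"
      unfolding R_def t by (intro infsum_cong) (simp add: scaleR_conv_of_real mult_ac flip: exp_of_real)
    moreover have "csqrt z = sqrt t"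
      using t by (simp add: csqrt_of_real)
    ultimately show ?thesis
      using theta_transformation_real[OF t(1), of a b] by simp
  qed
  have lim: "(1::complex) islimpt of_real ` {0<..}"
    unfolding islimpt_approachable
  proof safe
    fix e :: real assume "e > 0"
    then show "\<exists>x'\<in>complex_of_real ` {0<..}. x' \<noteq> 1 \<and> dist x' 1 < e"
      by (intro bexI[of _ "of_real (1 + e / 2)"] imageI) (auto simp: dist_norm simp flip: of_real_diff)
  qed
  have "L s - R (1 / s) / csqrt s = 0"
  proof (rule analytic_continuation[OF hol _ _ _ _ lim zero])
    show "connected {s. Re s > 0}"
      by (intro convex_connected convex_halfspace_Re_gt)
  qed (use s in \<open>auto simp: open_halfspace_Re_gt\<close>)
  then show ?thesis
    by (simp add: L_def R_def)
qed

lemma cis_pi_of_int: "cis (pi * of_int n) = (-1) powi n"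
  using cis_power_int[of pi n] by (simp add: mult.commute)

lemma gaussian_series_summable:
  fixes c :: "int \<Rightarrow> complex" and a :: real
  assumes c: "\<And>n. norm (c n) \<le> 1" and s: "Re s > 0"
  shows "(\<lambda>n. c n * exp (- of_real pi * s * (of_int n + of_real a)\<^sup>2)) summable_on UNIV"
proof (rule abs_summable_summable, rule summable_on_comparison_test)
  show "(\<lambda>n::int. exp (- (pi * Re s) * (of_int n + a)\<^sup>2)) summable_on UNIV"
    using s by (intro summable_on_gaussian) simp
  fix n :: int
  have "(of_int n + of_real a)\<^sup>2 = complex_of_real ((of_int n + a)\<^sup>2)"
    by simp
  then have "norm (exp (- of_real pi * s * (of_int n + of_real a)\<^sup>2)) = exp (- (pi * Re s) * (of_int n + a)\<^sup>2)"
    by (simp del: of_real_power)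
  then show "norm (c n * exp (- of_real pi * s * (of_int n + of_real a)\<^sup>2)) \<le> exp (- (pi * Re s) * (of_int n + a)\<^sup>2)"
    using mult_right_mono[OF c[of n], of "exp (- (pi * Re s) * (of_int n + a)\<^sup>2)"] by (simp add: norm_mult)
qed auto

lemma infsum_int_residue_classes:
  fixes f :: "int \<Rightarrow> 'a :: banach"
  assumes "k > 0" and f: "f summable_on UNIV"
  shows "(\<Sum>\<^sub>\<infinity>n. f n) = (\<Sum>u<k. \<Sum>\<^sub>\<infinity>n. f (int k * n + int u))"
proof -
  have bij: "bij_betw (\<lambda>(u, n). int k * n + int u) ({..<k} \<times> UNIV) UNIV"
    using assms(1)
    by (intro bij_betwI[of _ _ _ "\<lambda>n. (nat (n mod int k), n div int k)"]) (auto simp: nat_less_iff)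
  have "(\<Sum>\<^sub>\<infinity>n. f n) = (\<Sum>\<^sub>\<infinity>(u, n)\<in>{..<k} \<times> UNIV. f (int k * n + int u))"
    using infsum_reindex_bij_betw[OF bij, of f] by (simp add: case_prod_unfold)
  also have "\<dots> = (\<Sum>\<^sub>\<infinity>u\<in>{..<k}. \<Sum>\<^sub>\<infinity>n. f (int k * n + int u))"
    using f summable_on_reindex_bij_betw[OF bij, of f]
    by (intro infsum_Sigma'_banach[symmetric]) (simp add: case_prod_unfold)
  finally show ?thesis by simp
qed

section \<open>The theta series\<close>

lemma theta_g_uminus: "theta_g (- j) m \<tau> = theta_g j m \<tau>"
proof -
  have "of_int (- n) + of_int j / (2 * real m) = - (of_int n + of_int (- j) / (2 * real m))" for n
    by simp
  then show ?thesis
    unfolding theta_g_def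
    by (intro infsum_reindex_bij_witness[of _ uminus uminus])
      (simp_all only: power2_minus power_int_minus_one_minus UNIV_I minus_minus)
qed

text \<open>Adding 2 m to the index amounts to replacing n by n + 1, which changes the sign (-1)^n.
  Together with \<open>theta_g_uminus\<close> this makes the even-indexed series antisymmetric under
  the reflection of r to m - r in g_(2r).\<close>

lemma theta_g_shift:
  assumes "m > 0"
  shows "theta_g (j + 2 * int m) m \<tau> = - theta_g j m \<tau>"
proof -
  have "of_int n + of_int (j + 2 * int m) / (2 * real m) = of_int (n + 1) + of_int j / (2 * real m)" for n
    using assms by (simp add: field_simps)
  then have "theta_g (j + 2 * int m) m \<tau> =
      (\<Sum>\<^sub>\<infinity>n::int. - ((-1) powi (n + 1) * q_power \<tau> (real m * (of_int (n + 1) + of_int j / (2 * real m))\<^sup>2)))"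
    unfolding theta_g_def by (intro infsum_cong) (simp add: power_int_add add.assoc)
  also have "\<dots> = (\<Sum>\<^sub>\<infinity>n::int. - ((-1) powi n * q_power \<tau> (real m * (of_int n + of_int j / (2 * real m))\<^sup>2)))"
    by (rule infsum_reindex_bij_witness[of _ "\<lambda>n. n - 1" "\<lambda>n. n + 1"]) auto
  finally show ?thesis
    by (simp add: infsum_uminus theta_g_def)
qed

text \<open>This is the left side of \<open>theta_transformation\<close> with s = - 2 i \<tau> m, a
  = r / m and b = 1/2; the real part of s is 2 m Im \<tau>.\<close>

lemma theta_g_even:
  assumes "m > 0"
  shows "theta_g (2 * r) m \<tau> =
    (\<Sum>\<^sub>\<infinity>n::int. (-1) powi n * exp (- of_real pi * (- 2 * \<i> * \<tau> * of_nat m) * (of_int n + of_real (of_int r / real m))\<^sup>2))"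
proof -
  have "2 * of_real pi * \<i> * of_real (real m * (of_int n + of_int (2 * r) / (2 * real m))\<^sup>2) * \<tau> =
      - of_real pi * (- 2 * \<i> * \<tau> * of_nat m) * (of_int n + of_real (of_int r / real m))\<^sup>2" for n
    by (simp add: mult_ac)
  then show ?thesis
    unfolding theta_g_def q_power_def by (simp only:)
qed

text \<open>Modulo integers the exponent m (n + j / (2 m))^2 equals j^2 / (4 m), whatever n is, so
  one phase factors out of the series.\<close>

lemma theta_g_T:
  assumes "m > 0"
  shows "theta_g j m (\<tau> + 1) = cis (of_int (j\<^sup>2) / (2 * real m) * pi) * theta_g j m \<tau>"
proof -
  have "(-1) powi n * q_power (\<tau> + 1) (real m * (of_int n + of_int j / (2 * real m))\<^sup>2) =
     cis (of_int (j\<^sup>2) / (2 * real m) * pi) * ((-1) powi n * q_power \<tau> (real m * (of_int n + of_int j / (2 * real m))\<^sup>2))" for n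
  proof -
    define x where "x = real m * (of_int n + of_int j / (2 * real m))\<^sup>2"
    have x: "2 * pi * x = 2 * pi * of_int (int m * n\<^sup>2 + n * j) + of_int (j\<^sup>2) / (2 * real m) * pi"
      using assms by (simp add: x_def power2_eq_square field_simps)
    have "q_power (\<tau> + 1) x = cis (2 * pi * x) * q_power \<tau> x"
      by (simp add: q_power_def cis_conv_exp exp_add[symmetric] algebra_simps)
    also have "cis (2 * pi * x) = cis (of_int (j\<^sup>2) / (2 * real m) * pi)"
      unfolding x by (simp only: cis_mult[symmetric] cis_multiple_2pi Ints_of_int mult_1)
    finally show ?thesis
      by (simp add: x_def)
  qed
  then show ?thesis
    unfolding theta_g_def by (simp only: infsum_cmult_right')
qed

text \<open>Writing the summation index as k n + v, each step of length k multiplies the character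
  by -1 because 2 u + 1 is odd. This recreates the sign of the theta series, while the Gaussian
  acquires scale k and offset v / k, which is index 2 v.\<close>

lemma theta_g_residue_expansion:
  assumes k: "k > 0" and \<tau>: "Im \<tau> > 0"
  shows "(\<Sum>\<^sub>\<infinity>n::int. cis (- (pi * real (2 * u + 1) / real k * of_int n)) *
      exp (- of_real pi * (- 2 * \<i> * \<tau> / of_nat k) * (of_int n)\<^sup>2)) =
    (\<Sum>v<k. cis (- (pi * real (2 * u + 1) * real v / real k)) * theta_g (2 * int v) k \<tau>)" (is "infsum ?f UNIV = _")
proof -
  have "Re (- 2 * \<i> * \<tau> / of_nat k) > 0"
    using k \<tau> by (simp add: Re_divide_of_nat)
  then have "?f summable_on UNIV"
    using gaussian_series_summable[of "\<lambda>n. cis (- (pi * real (2 * u + 1) / real k * of_int n))" "- 2 * \<i> * \<tau> / of_nat k" 0]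
    by simp
  then have "infsum ?f UNIV = (\<Sum>v<k. \<Sum>\<^sub>\<infinity>n. ?f (int k * n + int v))"
    by (rule infsum_int_residue_classes[OF k])
  also have "\<dots> = (\<Sum>v<k. cis (- (pi * real (2 * u + 1) * real v / real k)) * theta_g (2 * int v) k \<tau>)"
  proof (rule sum.cong[OF refl])
    fix v
    have "?f (int k * n + int v) = cis (- (pi * real (2 * u + 1) * real v / real k)) *
       ((-1) powi n * exp (- of_real pi * (- 2 * \<i> * \<tau> * of_nat k) * (of_int n + of_real (of_int (int v) / real k))\<^sup>2))" for n
    proof -
      have "- (pi * real (2 * u + 1) / real k * of_int (int k * n + int v)) =
          - (pi * real (2 * u + 1) * real v / real k) + pi * of_int n + 2 * pi * of_int (- (int u + 1) * n)"
        using k by (simp add: field_simps)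
      then have "cis (- (pi * real (2 * u + 1) / real k * of_int (int k * n + int v))) =
          cis (- (pi * real (2 * u + 1) * real v / real k)) * (-1) powi n"
        by (simp only: cis_mult[symmetric] cis_multiple_2pi Ints_of_int mult_1_right cis_pi_of_int)
      moreover have "(- 2 * \<i> * \<tau> / of_nat k) * (of_int (int k * n + int v))\<^sup>2 =
          (- 2 * \<i> * \<tau> * of_nat k) * (of_int n + of_real (of_int (int v) / real k))\<^sup>2"
        using k by (simp add: field_simps power2_eq_square)
      ultimately show ?thesis
        by (simp only: mult.assoc)
    qed
    then show "(\<Sum>\<^sub>\<infinity>n. ?f (int k * n + int v)) = cis (- (pi * real (2 * u + 1) * real v / real k)) * theta_g (2 * int v) k \<tau>"
      unfolding theta_g_even[OF k] by (simp only: infsum_cmult_right')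
  qed
  finally show ?thesis .
qed

text \<open>Two Poisson summations leave a product of two principal square roots in the denominator.
  Here it is replaced by the single principal root of the modular transformation, without a sign
  ambiguity.\<close>

lemma csqrt_quotient:
  assumes "Re x > 0" "Re y > 0" "x * y * z = c\<^sup>2" "c > (0::real)"
  shows "1 / (csqrt x * csqrt y) = csqrt z / of_real c"
proof -
  have nz: "x \<noteq> 0" "y \<noteq> 0"
    using assms by auto
  \<comment> \<open>Both square roots have argument in \<open>(-\<pi>/4, \<pi>/4)\<close>, so their product stays in the right half plane.\<close>
  have *: "\<bar>Im (csqrt w)\<bar> < Re (csqrt w)" if "Re w > 0" for w
  proof -
    have "Re w = (Re (csqrt w))\<^sup>2 - (Im (csqrt w))\<^sup>2"
      by (metis Re_power2 power2_csqrt)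
    then have "\<bar>Im (csqrt w)\<bar>\<^sup>2 < (Re (csqrt w))\<^sup>2"
      using that by (simp del: csqrt.simps)
    then show ?thesis
      using Re_csqrt power_less_imp_less_base by blast
  qed
  have "Im (csqrt x) * Im (csqrt y) \<le> \<bar>Im (csqrt x)\<bar> * \<bar>Im (csqrt y)\<bar>"
    by (metis abs_ge_self abs_mult)
  also have "\<dots> < Re (csqrt x) * Re (csqrt y)"
    by (intro mult_strict_mono' * assms) auto
  finally have pos: "Re (csqrt x * csqrt y) > 0"
    by simp
  have "csqrt z = of_real c / (csqrt x * csqrt y)"
  proof (rule csqrt_unique)
    show "(of_real c / (csqrt x * csqrt y))\<^sup>2 = z"
      using nz assms(3) by (simp add: power_divide power_mult_distrib field_simps)
    have "Re (of_real c / (csqrt x * csqrt y)) = c * Re (csqrt x * csqrt y) / (cmod (csqrt x * csqrt y))\<^sup>2"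
      by (simp only: Re_divide' ) simp
    then show "0 < Re (of_real c / (csqrt x * csqrt y)) \<or>
        Re (of_real c / (csqrt x * csqrt y)) = 0 \<and> 0 \<le> Im (of_real c / (csqrt x * csqrt y))"
      using pos assms(4) nz by (auto intro!: divide_pos_pos mult_pos_pos simp del: times_complex.sel)
  qed
  then show ?thesis
    using assms(4) by simp
qed

lemma theta_g_transformation:
  fixes r :: int
  assumes k: "k > 0" and \<tau>: "Im \<tau> > 0"
  shows "theta_g (2 * r) k (\<tau> / (4 * \<tau> + 1)) = csqrt (4 * \<tau> + 1) / of_nat k *
    (\<Sum>u<k. cis (- (pi * real ((2 * u + 1)\<^sup>2) / (2 * real k))) * cis (- (pi * of_int r * real (2 * u + 1) / real k)) *
      (\<Sum>v<k. cis (- (pi * real (2 * u + 1) * real v / real k)) * theta_g (2 * int v) k \<tau>))"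
proof -
  define \<sigma> where "\<sigma> = \<tau> / (4 * \<tau> + 1)"
  \<comment> \<open>\<open>x\<close> is the Gaussian parameter of the series at \<sigma>. Within a
    residue class modulo k the dual parameter 1 / x is scaled by k^2, and k^2 / x = 2 i k +
    \<open>y\<close>: the first summand becomes a phase, the second is the parameter of the next
    summation.\<close>
  define x where "x = - 2 * \<i> * \<sigma> * of_nat k"
  define y where "y = \<i> * of_nat k / (2 * \<tau>)"
  have nz: "\<tau> \<noteq> 0" "4 * \<tau> + 1 \<noteq> 0"
    using \<tau> by (auto simp: complex_eq_iff)
  have "Im \<sigma> = Im \<tau> / ((Re (4 * \<tau> + 1))\<^sup>2 + (Im (4 * \<tau> + 1))\<^sup>2)"
    by (simp add: \<sigma>_def Im_divide algebra_simps)
  also have "\<dots> > 0"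
    using \<tau> nz(2) unfolding complex_neq_0 by (intro divide_pos_pos)
  finally have "Im \<sigma> > 0" .
  then have x: "Re x > 0"
    using k by (simp add: x_def)
  have y: "Re y > 0"
    using k \<tau> nz by (auto simp: y_def Re_divide intro!: divide_pos_pos add_nonneg_pos)
  have inv_x: "1 / x = \<i> / (2 * of_nat k) * (4 + 1 / \<tau>)" and inv_y: "1 / y = - 2 * \<i> * \<tau> / of_nat k"
    using nz k by (simp_all add: x_def y_def \<sigma>_def field_simps)
  have xy: "x * y * (4 * \<tau> + 1) = of_real ((real k)\<^sup>2)"
    using nz by (simp add: x_def y_def \<sigma>_def field_simps power2_eq_square)
  \<comment> \<open>Chosen so that (k n + u) + 1/2 = k (n + a u).\<close>
  define a where "a = (\<lambda>u. real (2 * u + 1) / (2 * real k))"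
  define f where "f = (\<lambda>n::int. cis (- (2 * pi * (of_int r / real k) * (of_int n + 1 / 2))) *
      exp (- of_real pi * (1 / x) * (of_int n + of_real (1 / 2))\<^sup>2))"
  have "theta_g (2 * r) k \<sigma> = (\<Sum>\<^sub>\<infinity>n. f n) / csqrt x"
    using theta_transformation[OF x, of "1 / 2" "of_int r / real k"]
    unfolding theta_g_even[OF k] f_def cis_pi_of_int[symmetric] x_def by simp
  also have "(\<Sum>\<^sub>\<infinity>n. f n) = (\<Sum>u<k. \<Sum>\<^sub>\<infinity>n. f (int k * n + int u))"
  proof (rule infsum_int_residue_classes[OF k])
    have "Re (1 / x) > 0"
      using x by (auto simp: Re_divide intro!: divide_pos_pos add_pos_nonneg)
    then show "f summable_on UNIV"
      unfolding f_def by (intro gaussian_series_summable) simp_all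
  qed
  also have "\<dots> = (\<Sum>u<k. cis (- (pi * real ((2 * u + 1)\<^sup>2) / (2 * real k))) * cis (- (pi * of_int r * real (2 * u + 1) / real k)) *
      (\<Sum>v<k. cis (- (pi * real (2 * u + 1) * real v / real k)) * theta_g (2 * int v) k \<tau>) / csqrt y)"
  proof (rule sum.cong[OF refl])
    fix u
    define p q where "p = cis (- (pi * real ((2 * u + 1)\<^sup>2) / (2 * real k)))"
      and "q = cis (- (pi * of_int r * real (2 * u + 1) / real k))"
    \<comment> \<open>The trivial factor with frequency 0 is kept so that the sum matches
      \<open>theta_transformation\<close> with b = 0. The phase \<open>p\<close> does not depend on
      n because 2 k (n + a u)^2 differs from (2 u + 1)^2 / (2 k) by an even integer; it is a
      diagonal entry of the Lambda matrix.\<close>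
    have "f (int k * n + int u) = p * q * (cis (2 * pi * 0 * of_int n) * exp (- of_real pi * y * (of_int n + of_real (a u))\<^sup>2))" for n
    proof -
      have n: "real_of_int (int k * n + int u) + 1 / 2 = real k * (of_int n + a u)"
        using k by (simp add: a_def field_simps)
      have "- (2 * pi * (of_int r / real k) * (of_int (int k * n + int u) + 1 / 2)) =
          - (pi * of_int r * real (2 * u + 1) / real k) + 2 * pi * of_int (- r * n)"
        unfolding n using k by (simp add: a_def field_simps)
      then have 1: "cis (- (2 * pi * (of_int r / real k) * (of_int (int k * n + int u) + 1 / 2))) = q"
        by (simp only: q_def cis_mult[symmetric] cis_multiple_2pi Ints_of_int mult_1_right)
      have n': "of_int (int k * n + int u) + of_real (1 / 2) = of_nat k * (of_int n + complex_of_real (a u))"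
        using arg_cong[OF n, of complex_of_real] by simp
      have "- of_real pi * (1 / x) * (of_int (int k * n + int u) + of_real (1 / 2))\<^sup>2 =
          - (2 * of_real pi * \<i> * of_nat k * (of_int n + complex_of_real (a u))\<^sup>2)
          + (- of_real pi * y * (of_int n + of_real (a u))\<^sup>2)"
        unfolding n' inv_x y_def using k nz(1) by (simp add: field_simps power2_eq_square)
      also have "- (2 * of_real pi * \<i> * of_nat k * (of_int n + complex_of_real (a u))\<^sup>2) =
          \<i> * of_real (- (2 * pi * (real k * (of_int n + a u)\<^sup>2)))"
        by simp
      also have "- (2 * pi * (real k * (of_int n + a u)\<^sup>2)) =
          - (pi * real ((2 * u + 1)\<^sup>2) / (2 * real k)) + 2 * pi * of_int (- (int k * n\<^sup>2 + n * (2 * int u + 1)))"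
        using k by (simp add: a_def field_simps power2_eq_square)
      finally have "exp (- of_real pi * (1 / x) * (of_int (int k * n + int u) + of_real (1 / 2))\<^sup>2) =
          p * exp (- of_real pi * y * (of_int n + of_real (a u))\<^sup>2)"
        by (simp only: exp_add cis_conv_exp[symmetric] p_def cis_mult[symmetric] cis_multiple_2pi Ints_of_int mult_1_right)
      with 1 show ?thesis
        unfolding f_def by simp
    qed
    then have "(\<Sum>\<^sub>\<infinity>n. f (int k * n + int u)) =
        p * q * (\<Sum>\<^sub>\<infinity>n. cis (2 * pi * 0 * of_int n) * exp (- of_real pi * y * (of_int n + of_real (a u))\<^sup>2))"
      by (simp only: infsum_cmult_right')
    also have "(\<Sum>\<^sub>\<infinity>n::int. cis (2 * pi * 0 * of_int n) * exp (- of_real pi * y * (of_int n + of_real (a u))\<^sup>2)) =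
        (\<Sum>\<^sub>\<infinity>n::int. cis (- (pi * real (2 * u + 1) / real k * of_int n)) *
          exp (- of_real pi * (- 2 * \<i> * \<tau> / of_nat k) * (of_int n)\<^sup>2)) / csqrt y"
    proof -
      have "2 * pi * a u * (of_int n + 0) = pi * real (2 * u + 1) / real k * of_int n" for n
        by (simp add: a_def)
      then show ?thesis
        using theta_transformation[OF y, of 0 "a u"] by (simp only: inv_y of_real_0 add_0_right)
    qed
    finally show "(\<Sum>\<^sub>\<infinity>n. f (int k * n + int u)) = p * q *
        (\<Sum>v<k. cis (- (pi * real (2 * u + 1) * real v / real k)) * theta_g (2 * int v) k \<tau>) / csqrt y"
      unfolding theta_g_residue_expansion[OF k \<tau>] by simp
  qed
  also have "\<dots> / csqrt x = 1 / (csqrt x * csqrt y) * (\<Sum>u<k. cis (- (pi * real ((2 * u + 1)\<^sup>2) / (2 * real k))) * cis (- (pi * of_int r * real (2 * u + 1) / real k)) *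
      (\<Sum>v<k. cis (- (pi * real (2 * u + 1) * real v / real k)) * theta_g (2 * int v) k \<tau>))"
    by (simp add: sum_divide_distrib[symmetric] del: csqrt.simps)
  also have "1 / (csqrt x * csqrt y) = csqrt (4 * \<tau> + 1) / of_real (real k)"
    using csqrt_quotient[OF x y xy] k by simp
  finally show ?thesis
    by (simp add: \<sigma>_def)
qed

text \<open>The reflection of u to k - 1 - u has a fixed point only for odd k, namely u = (k - 1) /
  2, which must be counted once. This is the source of the factor 1/2 in
  \<open>b_entry\<close>.\<close>

lemma sum_lessThan_fold:
  fixes h :: "nat \<Rightarrow> 'a::comm_monoid_add"
  shows "(\<Sum>u<k. h u) = (\<Sum>u<(k + 1) div 2. if 2 * u + 1 = k then h u else h u + h (k - 1 - u))"
proof -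
  have "(\<Sum>u<(k + 1) div 2. if 2 * u + 1 = k then h u else h u + h (k - 1 - u)) =
      (\<Sum>u<(k + 1) div 2. h u + (if 2 * u + 1 = k then 0 else h (k - 1 - u)))"
    by (intro sum.cong) auto
  also have "\<dots> = (\<Sum>u<(k + 1) div 2. h u) + (\<Sum>u<(k + 1) div 2. if 2 * u + 1 = k then 0 else h (k - 1 - u))"
    by (rule sum.distrib)
  also have "(\<Sum>u<(k + 1) div 2. if 2 * u + 1 = k then 0 else h (k - 1 - u)) = (\<Sum>u<k div 2. h (k - 1 - u))"
    by (intro sum.mono_neutral_cong_right) auto
  also have "\<dots> = (\<Sum>u\<in>{(k + 1) div 2..<k}. h u)"
    by (rule sum.reindex_bij_witness[of _ "\<lambda>u. k - 1 - u" "\<lambda>u. k - 1 - u"]) auto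
  also have "(\<Sum>u<(k + 1) div 2. h u) + (\<Sum>u\<in>{(k + 1) div 2..<k}. h u) = (\<Sum>u<k. h u)"
    unfolding lessThan_atLeast0 by (rule sum.atLeastLessThan_concat) auto
  finally show ?thesis ..
qed

text \<open>Under the reflection of v to k - v the theta series changes sign, and the character
  changes sign and is conjugated, so each pair adds up to twice a cosine. The index v = 0 has no
  partner, whence the entries 1/2 in the first column of C_k. For even k the fixed point v = k / 2
  contributes 0, so the vector can stop below k.\<close>

lemma sum_theta_g_fold:
  assumes k: "k > 0"
  shows "(\<Sum>v<k. cis (- (pi * real (2 * u + 1) * real v / real k)) * theta_g (2 * int v) k \<tau>) =
    2 * (\<Sum>v<(k + 1) div 2. of_real (c_entry k (u + 1) (v + 1)) * theta_g (2 * int v) k \<tau>)"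
proof -
  define \<theta> where "\<theta> = (\<lambda>v. theta_g (2 * int v) k \<tau>)"
  define t where "t = (\<lambda>v. cis (- (pi * real (2 * u + 1) * real v / real k)) * \<theta> v)"
  define g where "g = (\<lambda>v. 2 * (of_real (cos (pi * real (2 * u + 1) * real v / real k)) * \<theta> v))"
  have reflect: "\<theta> (k - v) = - \<theta> v" if "v \<le> k" for v
    using theta_g_shift[OF k, of "- (2 * int v)" \<tau>] theta_g_uminus[of "2 * int v" k \<tau>] that
    by (simp add: \<theta>_def of_nat_diff algebra_simps)
  have t_reflect: "t v + t (k - v) = g v" if "v \<le> k" for v
  proof -
    have "- (pi * real (2 * u + 1) * real (k - v) / real k) =
        pi * real (2 * u + 1) * real v / real k + pi + 2 * pi * of_int (- (int u + 1))"
      using that k by (simp add: of_nat_diff field_simps)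
    then have "cis (- (pi * real (2 * u + 1) * real (k - v) / real k)) = - cis (pi * real (2 * u + 1) * real v / real k)"
      by (simp only: cis_mult[symmetric] cis_multiple_2pi Ints_of_int mult_1_right cis_pi) simp
    then have "t v + t (k - v) = (cis (- (pi * real (2 * u + 1) * real v / real k)) + cis (pi * real (2 * u + 1) * real v / real k)) * \<theta> v"
      by (simp add: t_def reflect[OF that] ring_distribs)
    also have "cis (- (pi * real (2 * u + 1) * real v / real k)) + cis (pi * real (2 * u + 1) * real v / real k) =
       2 * of_real (cos (pi * real (2 * u + 1) * real v / real k))"
      by (simp add: complex_eq_iff)
    finally show ?thesis by (simp add: g_def)
  qed
  have mid: "\<theta> v = 0" if "2 * v = k" for v
  proof -
    have "k - v = v" using that by simp
    then have "\<theta> v = - \<theta> v"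
      using reflect[of v] that by simp
    then show ?thesis by simp
  qed
  obtain m where m: "k = Suc m"
    using k gr0_implies_Suc by blast
  \<comment> \<open>With v = w + 1 the reflection of v to k - v becomes that of w to m - 1 - w, the
    form needed by \<open>sum_lessThan_fold\<close>.\<close>
  have "(\<Sum>v<k. t v) = t 0 + (\<Sum>w<m. t (Suc w))"
    unfolding m by (rule sum.lessThan_Suc_shift)
  also have "(\<Sum>w<m. t (Suc w)) = (\<Sum>w<(m + 1) div 2. if 2 * w + 1 = m then t (Suc w) else t (Suc w) + t (Suc (m - 1 - w)))"
    by (rule sum_lessThan_fold)
  also have "\<dots> = (\<Sum>w<(m + 1) div 2. g (Suc w))"
  proof (intro sum.cong refl)
    fix w assume w: "w \<in> {..<(m + 1) div 2}"
    show "(if 2 * w + 1 = m then t (Suc w) else t (Suc w) + t (Suc (m - 1 - w))) = g (Suc w)"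
    proof (cases "2 * w + 1 = m")
      case True
      then have "\<theta> (Suc w) = 0"
        using m by (intro mid) simp
      then show ?thesis
        using True by (simp add: t_def g_def)
    next
      case False
      then have "Suc (m - 1 - w) = k - Suc w"
        using w m by auto
      then show ?thesis
        using False t_reflect[of "Suc w"] w m by auto
    qed
  qed
  \<comment> \<open>The ranges differ only for even k, by the index v = k / 2 with vanishing theta
    series.\<close>
  also have "\<dots> = (\<Sum>w<m div 2. g (Suc w))"
  proof (intro sum.mono_neutral_right ballI)
    fix w assume "w \<in> {..<(m + 1) div 2} - {..<m div 2}"
    then have "\<theta> (Suc w) = 0"
      using m by (intro mid) auto
    then show "g (Suc w) = 0"
      by (simp add: g_def)
  qed auto
  also have "t 0 + (\<Sum>w<m div 2. g (Suc w)) =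
      2 * (\<Sum>v<Suc (m div 2). of_real (c_entry k (u + 1) (v + 1)) * \<theta> v)"
    unfolding sum.lessThan_Suc_shift distrib_left sum_distrib_left
    by (intro arg_cong2[where f = "(+)"] sum.cong) (simp_all add: t_def g_def c_entry_def algebra_simps)
  also have "Suc (m div 2) = (k + 1) div 2"
    using m by simp
  finally show ?thesis
    by (simp add: t_def \<theta>_def)
qed

text \<open>Replacing u by k - 1 - u replaces 2 u + 1 by 2 k - (2 u + 1). This preserves the phase
  \<open>l\<close> and the inner sum \<open>C\<close> and conjugates \<open>e\<close>, so pairs give
  2 cos. At the middle index \<open>e\<close> is real and occurs once, which is again twice the
  halved entry. The inner fold has already given a 2, hence the 4.\<close>

lemma theta_g_transformation_folded:
  assumes k: "k > 0" and \<tau>: "Im \<tau> > 0"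
  shows "theta_g (2 * int r) k (\<tau> / (4 * \<tau> + 1)) = 4 * csqrt (4 * \<tau> + 1) / of_nat k *
    (\<Sum>u<(k + 1) div 2. of_real (b_entry k (r + 1) (u + 1)) * cis (- (pi * real ((2 * u + 1)\<^sup>2) / (2 * real k))) *
      (\<Sum>v<(k + 1) div 2. of_real (c_entry k (u + 1) (v + 1)) * theta_g (2 * int v) k \<tau>))"
proof -
  define l where "l = (\<lambda>u. cis (- (pi * real ((2 * u + 1)\<^sup>2) / (2 * real k))))"
  define e where "e = (\<lambda>u. cis (- (pi * of_int (int r) * real (2 * u + 1) / real k)))"
  define C where "C = (\<lambda>u. (\<Sum>v<(k + 1) div 2. of_real (c_entry k (u + 1) (v + 1)) * theta_g (2 * int v) k \<tau>))"
  have reflect: "real (2 * (k - 1 - u) + 1) = 2 * real k - real (2 * u + 1)" if "u < k" for u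
    using that by (simp add: of_nat_diff)
  have l: "l (k - 1 - u) = l u" if "u < k" for u
  proof -
    have "- (pi * real ((2 * (k - 1 - u) + 1)\<^sup>2) / (2 * real k)) =
        - (pi * real ((2 * u + 1)\<^sup>2) / (2 * real k)) + 2 * pi * of_int (2 * int u + 1 - int k)"
      unfolding of_nat_power reflect[OF that] using k by (simp add: field_simps power2_eq_square)
    then show ?thesis
      by (simp only: l_def cis_mult[symmetric] cis_multiple_2pi Ints_of_int mult_1_right)
  qed
  have e: "e (k - 1 - u) = cnj (e u)" if "u < k" for u
  proof -
    have "- (pi * of_int (int r) * real (2 * (k - 1 - u) + 1) / real k) =
        pi * of_int (int r) * real (2 * u + 1) / real k + 2 * pi * of_int (- int r)"
      unfolding reflect[OF that] using k by (simp add: field_simps)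
    then show ?thesis
      by (simp only: e_def cis_mult[symmetric] cis_multiple_2pi Ints_of_int mult_1_right cis_cnj minus_minus)
  qed
  have C: "C (k - 1 - u) = C u" if "u < k" for u
  proof -
    have "c_entry k (k - 1 - u + 1) (v + 1) = c_entry k (u + 1) (v + 1)" for v
    proof -
      have "(2 * real (k - 1 - u + 1) - 1) * (real (v + 1) - 1) * pi / real k =
          2 * pi * of_int (int v) - (2 * real (u + 1) - 1) * (real (v + 1) - 1) * pi / real k"
        using that k by (simp add: of_nat_diff field_simps)
      then show ?thesis
        unfolding c_entry_def by (simp only: cos_diff cos_int_2pin sin_int_2pin) simp
    qed
    then show ?thesis
      by (simp add: C_def)
  qed
  have b: "(if 2 * u + 1 = k then e u else e u + cnj (e u)) = 2 * of_real (b_entry k (r + 1) (u + 1))"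
    if "u < (k + 1) div 2" for u
  proof (cases "2 * u + 1 = k")
    case True
    have "e u = cis (- (pi * real r))"
      unfolding e_def True using k by simp
    also have "\<dots> = of_real (cos (real r * pi))"
      by (simp add: complex_eq_iff sin_npi mult.commute)
    finally show ?thesis
      using True by (auto simp: b_entry_def)
  next
    case False
    then have "\<not> (odd k \<and> u + 1 = (k + 1) div 2)"
      by (auto elim!: oddE)
    moreover have "e u + cnj (e u) = 2 * of_real (cos (real r * (1 + 2 * real u) * pi / real k))"
      by (simp add: e_def complex_eq_iff mult_ac add_ac)
    ultimately show ?thesis
      using False by (auto simp: b_entry_def)
  qed
  have "(\<Sum>u<k. l u * e u * (2 * C u)) =
      (\<Sum>u<(k + 1) div 2. if 2 * u + 1 = k then l u * e u * (2 * C u) else l u * e u * (2 * C u) + l (k - 1 - u) * e (k - 1 - u) * (2 * C (k - 1 - u)))"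
    by (rule sum_lessThan_fold)
  also have "\<dots> = (\<Sum>u<(k + 1) div 2. l u * (2 * C u) * (if 2 * u + 1 = k then e u else e u + cnj (e u)))"
  proof (intro sum.cong refl)
    fix u assume "u \<in> {..<(k + 1) div 2}"
    then have u: "u < k" by auto
    show "(if 2 * u + 1 = k then l u * e u * (2 * C u) else l u * e u * (2 * C u) + l (k - 1 - u) * e (k - 1 - u) * (2 * C (k - 1 - u))) =
        l u * (2 * C u) * (if 2 * u + 1 = k then e u else e u + cnj (e u))"
      unfolding l[OF u] e[OF u] C[OF u] by (simp add: algebra_simps)
  qed
  also have "\<dots> = (\<Sum>u<(k + 1) div 2. 4 * (of_real (b_entry k (r + 1) (u + 1)) * l u * C u))"
    by (intro sum.cong refl, subst b) simp_all
  also have "\<dots> = 4 * (\<Sum>u<(k + 1) div 2. of_real (b_entry k (r + 1) (u + 1)) * l u * C u)"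
    by (rule sum_distrib_left[symmetric])
  finally show ?thesis
    using theta_g_transformation[OF k \<tau>, of "int r"]
    unfolding sum_theta_g_fold[OF k] l_def e_def C_def by simp
qed

section \<open>Matrix form\<close>

text \<open>Together with \<open>t_max_div_2\<close> this makes the dimensions compatible: s_k = 2
  ((k - 1) div 2), and the largest odd number up to k is s_k + 1, so both index sets have (k + 1)
  div 2 elements.\<close>

lemma s_max_div_2: "k > 0 \<Longrightarrow> s_max k div 2 + 1 = (k + 1) div 2"
proof -
  assume "k > 0"
  have "s_max k = 2 * ((k - 1) div 2)"
    unfolding s_max_def
    by (rule Max_eqI) (use \<open>k > 0\<close> in \<open>auto elim!: evenE intro: finite_subset[of _ "{..<k}"]\<close>)
  then show ?thesis
    using \<open>k > 0\<close> by simp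
qed

lemma t_max_div_2: "k > 0 \<Longrightarrow> t_max k div 2 + 1 = (k + 1) div 2"
proof -
  assume "k > 0"
  have "t_max k = 2 * ((k - 1) div 2) + 1"
    unfolding t_max_def
    by (rule Max_eqI) (use \<open>k > 0\<close> in \<open>auto elim!: oddE intro: finite_subset[of _ "{..k}"]\<close>)
  then show ?thesis
    using \<open>k > 0\<close> by simp
qed

lemma mat_diag_mult_vec:
  fixes w :: "'a :: semiring_1 vec"
  assumes "w \<in> carrier_vec n"
  shows "mat_diag n f *\<^sub>v w = vec n (\<lambda>i. f i * vec_index w i)"
proof (rule eq_vecI)
  fix i assume "i < dim_vec (vec n (\<lambda>i. f i * vec_index w i))"
  then have i: "i < n" by simp
  have "vec_index (mat_diag n f *\<^sub>v w) i = (\<Sum>j<n. (if i = j then f j else 0) * vec_index w j)"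
    using i assms by (simp add: mat_diag_def scalar_prod_def lessThan_atLeast0)
  also have "\<dots> = (\<Sum>j<n. if i = j then f i * vec_index w i else 0)"
    by (intro sum.cong) auto
  finally show "vec_index (mat_diag n f *\<^sub>v w) i = vec_index (vec n (\<lambda>i. f i * vec_index w i)) i"
    using i by simp
qed (simp add: mat_diag_def)

lemma smult_mat_mult_vec:
  fixes w :: "'a :: comm_semiring_0 vec"
  assumes "A \<in> carrier_mat m n" "w \<in> carrier_vec n"
  shows "(c \<cdot>\<^sub>m A) *\<^sub>v w = c \<cdot>\<^sub>v (A *\<^sub>v w)"
  using assms by (intro eq_vecI) (auto simp: scalar_prod_def sum_distrib_left mult.assoc)

theorem theorem1p4:
  fixes k :: nat and \<tau> :: complex
  assumes "k \<ge> 2" and "Im \<tau> > 0"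
  shows "G_vec k (\<tau> + 1) = T_mat k *\<^sub>v G_vec k \<tau> \<and>
         G_vec k (\<tau> / (4 * \<tau> + 1)) =
           ((4 * csqrt (4 * \<tau> + 1) / of_nat k) \<cdot>\<^sub>m (B_mat k * Lambda_mat k * C_mat k)) *\<^sub>v G_vec k \<tau>"
proof
  define N where "N = (k + 1) div 2"
  have k: "k > 0" using assms(1) by simp
  have N: "s_max k div 2 + 1 = N" "t_max k div 2 + 1 = N"
    using k by (simp_all only: N_def s_max_div_2 t_max_div_2)
  have G: "G_vec k t = vec N (\<lambda>i. theta_g (2 * int i) k t)" for t
    by (simp only: G_vec_def N of_nat_mult of_nat_numeral)
  have G_dim: "G_vec k t \<in> carrier_vec N" for t
    by (simp add: G)
  have B_eq: "B_mat k = mat N N (\<lambda>(i, j). of_real (b_entry k (i + 1) (j + 1)))"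
    and C_eq: "C_mat k = mat N N (\<lambda>(i, j). of_real (c_entry k (i + 1) (j + 1)))"
    by (simp_all only: B_mat_def C_mat_def N_def)
  have B: "B_mat k \<in> carrier_mat N N" and C: "C_mat k \<in> carrier_mat N N"
    by (simp_all add: B_eq C_eq)
  have L: "Lambda_mat k \<in> carrier_mat N N"
    by (simp only: Lambda_mat_def N mat_diag_dim)
  show "G_vec k (\<tau> + 1) = T_mat k *\<^sub>v G_vec k \<tau>"
    unfolding T_mat_def N mat_diag_mult_vec[OF G_dim]
    by (rule eq_vecI) (simp_all add: G theta_g_T[OF k] cis_conv_exp mult_ac)
  have Lw: "Lambda_mat k *\<^sub>v w = vec N (\<lambda>u. cis (- (pi * real ((2 * u + 1)\<^sup>2) / (2 * real k))) * vec_index w u)"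
    if "w \<in> carrier_vec N" for w
    unfolding Lambda_mat_def N mat_diag_mult_vec[OF that] by (rule eq_vecI) (simp_all add: cis_conv_exp mult_ac)
  define K where "K = 4 * csqrt (4 * \<tau> + 1) / of_nat k"
  \<comment> \<open>Applying the factors to the vector one at a time reproduces the nested sums of
    \<open>theta_g_transformation_folded\<close> without computing a matrix product.\<close>
  have "(K \<cdot>\<^sub>m (B_mat k * Lambda_mat k * C_mat k)) *\<^sub>v G_vec k \<tau> =
      K \<cdot>\<^sub>v (B_mat k *\<^sub>v (Lambda_mat k *\<^sub>v (C_mat k *\<^sub>v G_vec k \<tau>)))"
    using B C L G_dim
    by (simp add: smult_mat_mult_vec[of _ N N] assoc_mult_mat_vec[of _ N N _ N])
  also have "\<dots> = G_vec k (\<tau> / (4 * \<tau> + 1))"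
  proof (rule eq_vecI)
    fix r assume "r < dim_vec (G_vec k (\<tau> / (4 * \<tau> + 1)))"
    then have r: "r < N" by (simp add: G)
    have Cw: "C_mat k *\<^sub>v G_vec k \<tau> = vec N (\<lambda>u. \<Sum>v<N. of_real (c_entry k (u + 1) (v + 1)) * theta_g (2 * int v) k \<tau>)"
      by (rule eq_vecI) (simp_all add: G C_eq scalar_prod_def lessThan_atLeast0)
    show "vec_index (K \<cdot>\<^sub>v (B_mat k *\<^sub>v (Lambda_mat k *\<^sub>v (C_mat k *\<^sub>v G_vec k \<tau>)))) r = vec_index (G_vec k (\<tau> / (4 * \<tau> + 1))) r"
      using r unfolding Cw Lw[OF vec_carrier]
      by (simp add: G theta_g_transformation_folded[OF k assms(2), folded N_def K_def] B_eq scalar_prod_def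
          lessThan_atLeast0 mult.assoc del: of_nat_Suc csqrt.simps)
  qed (simp add: G B_eq)
  finally show "G_vec k (\<tau> / (4 * \<tau> + 1)) =
      ((4 * csqrt (4 * \<tau> + 1) / of_nat k) \<cdot>\<^sub>m (B_mat k * Lambda_mat k * C_mat k)) *\<^sub>v G_vec k \<tau>"
    by (simp only: K_def)
qed

end
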